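(* Let $q=p^s$ where $p$ is an odd prime and $s\geq 1$ is an integer, let $H=\{x^2\mid x\in\mathbb{F}_q^*\}$ be the set of nonzero squares (quadratic residues) in $\mathbb{F}_q$, and let $k$ be an integer with $1\leq k\leq |H|=\frac{q-1}{2}$. Let $b\in\mathbb{F}_q^*$ and let $N_H(k,b)$ be the number of $k$-element subsets $S\subseteq H$ with $\sum_{a\in S}a=b$. (1) If either $p\equiv 1 \pmod 4$, or $p\equiv 3\pmod 4$ and $s$ is even, then $$N_H(k,b)=\frac{1}{q}\binom{\frac{q-1}{2}}{k}-\frac{(-1)^k}{2q\,k!}\Big\{(1-\sqrt{q})A_{k,b}\Big(\tfrac{1-\sqrt{q}}{2},\tfrac{1+\sqrt{q}}{2},\tfrac{1-q}{2}\Big)+(1+\sqrt{q})A_{k,b}\Big(\tfrac{1+\sqrt{q}}{2},\tfrac{1-\sqrt{q}}{2},\tfrac{1-q}{2}\Big)\Big\}.$$ (2) If $p\equiv 3\pmod 4$ and $s$ is odd, then $$N_H(k,b)=\frac{1}{q}\binom{\frac{q-1}{2}}{k}-\frac{(-1)^k}{2q\,k!}\Big\{(1+\sqrt{q}i)A_{k,b}\Big(\tfrac{1-\sqrt{q}i}{2},\tfrac{1+\sqrt{q}i}{2},\tfrac{1-q}{2}\Big)+(1-\sqrt{q}i)A_{k,b}\Big(\tfrac{1+\sqrt{q}i}{2},\tfrac{1-\sqrt{q}i}{2},\tfrac{1-q}{2}\Big)\Big\},$$ where $i=\sqrt{-1}$.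
   Context: $\chi$ denotes the quadratic character of $\mathbb{F}_q^*$ ($\chi(x)=1$ if $x$ is a nonzero square, $-1$ otherwise), and for an integer $j$, $\chi(j)$ means $\chi$ evaluated at the image of $j$ in $\mathbb{F}_q$. For integers $c_1,\dots,c_k\geq 0$ with $\sum_{j} jc_j=k$, let $N(c_1,\dots,c_k)=\frac{k!}{1^{c_1}c_1!\,2^{c_2}c_2!\cdots k^{c_k}c_k!}$ (the number of permutations in $S_k$ with exactly $c_j$ cycles of length $j$ for each $j$). For $b\in\mathbb{F}_q^*$ and complex numbers $u,v,w$, define $$A_{k,b}(u,v,w)=\sum_{c_1,\dots,c_k\ge 0,\ \sum_j jc_j=k}N(c_1,\dots,c_k)\,t_1^{c_1}t_2^{c_2}\cdots t_k^{c_k},$$ where $t_j=u$ if $p\nmid j$ and $\chi(j)=\chi(b)$; $t_j=v$ if $p\nmid j$ and $\chi(j)=-\chi(b)$; $t_j=w$ if $p\mid j$. For real $x$ and integer $j\ge0$, $\binom{x}{j}=x(x-1)\cdots(x-j+1)/j!$. *)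

theory Defs
  imports Complex_Main "HOL-Library.Cardinality" "HOL-Number_Theory.Cong"
begin

definition nonzero_squares :: "'a::field set" where
  "nonzero_squares = {x ^ 2 |x. x \<noteq> 0}"

text \<open>Only the values on nonzero arguments matter; we use the conventional value 0 at 0.\<close>
definition quad_char :: "'a::field \<Rightarrow> int" where
  "quad_char x = (if x = 0 then 0 else if x \<in> nonzero_squares then 1 else -1)"

text \<open>A tuple $(c_1, \dots, c_k)$ is a function on naturals vanishing outside $\{1, \dots, k\}$.\<close>
definition cycle_types :: "nat \<Rightarrow> (nat \<Rightarrow> nat) set" where
  "cycle_types k = {c. (\<forall>j. j \<notin> {1..k} \<longrightarrow> c j = 0) \<and> (\<Sum>j = 1..k. j * c j) = k}"

definition perm_count :: "nat \<Rightarrow> (nat \<Rightarrow> nat) \<Rightarrow> complex" where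
  "perm_count k c = fact k / (\<Prod>j = 1..k. of_nat j ^ c j * fact (c j))"

text \<open>For \<open>p\<close> the characteristic, \<open>p\<close> not dividing \<open>j\<close> and \<open>b \<noteq> 0\<close> both characters are $\pm 1$,
  so the last case is $\chi(j) = -\chi(b)$.\<close>
definition cycle_weight ::
  "nat \<Rightarrow> 'a::field \<Rightarrow> complex \<Rightarrow> complex \<Rightarrow> complex \<Rightarrow> nat \<Rightarrow> complex" where
  "cycle_weight p b u v w j =
     (if p dvd j then w
      else if quad_char (of_nat j :: 'a) = quad_char b then u
      else v)"

definition A_poly ::
  "nat \<Rightarrow> nat \<Rightarrow> 'a::field \<Rightarrow> complex \<Rightarrow> complex \<Rightarrow> complex \<Rightarrow> complex" where
  "A_poly p k b u v w =
     (\<Sum>c \<in> cycle_types k. perm_count k c * (\<Prod>j = 1..k. cycle_weight p b u v w j ^ c j))"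

definition subset_sum_count :: "'a::field set \<Rightarrow> nat \<Rightarrow> 'a \<Rightarrow> nat" where
  "subset_sum_count H k b = card {S. S \<subseteq> H \<and> card S = k \<and> (\<Sum>a\<in>S. a) = b}"

lemma finite_cycle_types: "finite (cycle_types k)"
proof (rule finite_subset)
  show "cycle_types k \<subseteq> {c. \<forall>j. (j \<in> {1..k} \<longrightarrow> c j \<in> {..k}) \<and> (j \<notin> {1..k} \<longrightarrow> c j = 0)}"
  proof
    fix c assume c: "c \<in> cycle_types k"
    have "c j \<le> k" if j: "j \<in> {1..k}" for j
    proof -
      have "c j \<le> j * c j" using j by simp
      also have "\<dots> \<le> (\<Sum>j = 1..k. j * c j)"
        by (rule member_le_sum) (use j in auto)
      also have "\<dots> = k" using c by (simp add: cycle_types_def)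
      finally show ?thesis .
    qed
    then show "c \<in> {c. \<forall>j. (j \<in> {1..k} \<longrightarrow> c j \<in> {..k}) \<and> (j \<notin> {1..k} \<longrightarrow> c j = 0)}"
      using c by (auto simp: cycle_types_def)
  qed
  show "finite {c :: nat \<Rightarrow> nat. \<forall>j. (j \<in> {1..k} \<longrightarrow> c j \<in> {..k}) \<and> (j \<notin> {1..k} \<longrightarrow> c j = 0)}"
    by (rule finite_set_of_finite_funs) auto
qed

end

theory Submission
  imports Defs "HOL-Computational_Algebra.Formal_Power_Series" "HOL-Number_Theory.Residues"
    "HOL-Computational_Algebra.Polynomial"
begin

text \<open>
  Fix a nontrivial additive character $\psi$ of the field. By orthogonality, $q N_H(k,b)$ is the sum
  over all $c$ of $\psi(-cb)$ times the $k$-th elementary symmetric function of the values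
  $\psi(ca)$, $a \in H$. The term $c = 0$ gives the binomial coefficient. For $c \ne 0$ the
  elementary symmetric function is a sum over cycle types in the power sums
  $\sum_{a \in H} \psi(jca)$, which equal $(\chi(jc) G - 1)/2$ if $p \nmid j$ and $(q-1)/2$ otherwise,
  where $G$ is the quadratic Gauss sum. It therefore depends on $c$ only through $\chi(cb)$.
  As $G^2 = \chi(-1) q$ and the resulting expression is invariant under
  $G \mapsto -G$, the sign of $G$ is irrelevant.
\<close>

section \<open>Elementary symmetric functions as sums over cycle types\<close>

text \<open>A part \<open>j > k\<close> would already force \<open>j * c j > k\<close>, so enlarging
  the index range adds no cycle types. This lets types of \<open>k\<close> and of
  \<open>k - j\<close> be compared over one common range.\<close>

lemma cycle_types_alt:
  assumes "k \<le> n"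
  shows "cycle_types k = {c. (\<forall>j. j \<notin> {1..n} \<longrightarrow> c j = 0) \<and> (\<Sum>j = 1..n. j * c j) = k}"
proof (intro Set.set_eqI iffI)
  fix c assume "c \<in> cycle_types k"
  then have c: "\<And>j. j \<notin> {1..k} \<Longrightarrow> c j = 0" "(\<Sum>j = 1..k. j * c j) = k"
    by (auto simp: cycle_types_def)
  have "(\<Sum>j = 1..n. j * c j) = (\<Sum>j = 1..k. j * c j)"
    by (rule sum.mono_neutral_right) (use assms c in auto)
  with c assms show "c \<in> {c. (\<forall>j. j \<notin> {1..n} \<longrightarrow> c j = 0) \<and> (\<Sum>j = 1..n. j * c j) = k}"
    by auto
next
  fix c assume "c \<in> {c. (\<forall>j. j \<notin> {1..n} \<longrightarrow> c j = 0) \<and> (\<Sum>j = 1..n. j * c j) = k}"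
  then have c: "\<And>j. j \<notin> {1..n} \<Longrightarrow> c j = 0" "(\<Sum>j = 1..n. j * c j) = k"
    by auto
  have supp: "c j = 0" if "j \<notin> {1..k}" for j
  proof (cases "j \<in> {1..n}")
    case True
    have "j * c j \<le> (\<Sum>j = 1..n. j * c j)"
      by (rule member_le_sum) (use True in auto)
    with c have "j * c j \<le> k" by simp
    moreover from that True have "k < j" by auto
    ultimately have "j * c j < j * 1" by linarith
    then show ?thesis by (simp only: mult_less_cancel1) simp
  qed (use c in auto)
  have "(\<Sum>j = 1..n. j * c j) = (\<Sum>j = 1..k. j * c j)"
    by (rule sum.mono_neutral_right) (use assms supp in auto)
  with supp c show "c \<in> cycle_types k"
    by (auto simp: cycle_types_def)
qed

text \<open>The cycle index polynomial of the symmetric group on \<open>k\<close> letters, evaluated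
  at \<open>t\<close>; equivalently the coefficient of \<open>X^k\<close> in the exponential of the
  series with coefficients \<open>t j / j\<close>, \<open>j \<ge> 1\<close>.\<close>

definition cycle_sum :: "(nat \<Rightarrow> complex) \<Rightarrow> nat \<Rightarrow> complex" where
  "cycle_sum t k = (\<Sum>c\<in>cycle_types k. \<Prod>j = 1..k. t j ^ c j / (of_nat j ^ c j * fact (c j)))"

lemma A_poly_eq_cycle_sum:
  "A_poly p k b u v w = fact k * cycle_sum (cycle_weight p b u v w) k"
  by (simp add: A_poly_def cycle_sum_def perm_count_def sum_distrib_left prod_dividef)

lemma cycle_sum_0: "cycle_sum t 0 = 1"
proof -
  have "cycle_types 0 = {\<lambda>_. 0}"
    by (auto simp: cycle_types_def)
  then show ?thesis by (simp add: cycle_sum_def)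
qed

text \<open>Removing one cycle of length \<open>j\<close> from a cycle type of \<open>k\<close> leaves a cycle type of \<open>k - j\<close>.\<close>
lemma cycle_sum_rec:
  "of_nat k * cycle_sum t k = (\<Sum>j = 1..k. t j * cycle_sum t (k - j))"
proof -
  define w where "w = (\<lambda>j m. t j ^ m / (of_nat j ^ m * fact m :: complex))"
  \<comment> \<open>The change of the summand when one cycle of length \<open>j\<close> is
    removed.\<close>
  have w_Suc: "of_nat j * of_nat (Suc m) * w j (Suc m) = t j * w j m" if "j \<ge> 1" for j m
  proof -
    have "of_nat j * of_nat (Suc m) \<noteq> (0::complex)"
      using that by (simp del: of_nat_Suc)
    then show ?thesis
      by (simp add: w_def divide_simps del: of_nat_Suc)
  qed
  \<comment> \<open>All products are extended to \<open>{1..k}\<close>; the added factors are 1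
    because their exponents vanish.\<close>
  have cs: "cycle_sum t m = (\<Sum>c\<in>cycle_types m. \<Prod>j = 1..k. w j (c j))" if "m \<le> k" for m
    unfolding cycle_sum_def w_def
  proof (intro sum.cong refl prod.mono_neutral_left ballI)
    fix c i assume "c \<in> cycle_types m" "i \<in> {1..k} - {1..m}"
    then have "c i = 0" by (auto simp: cycle_types_def)
    then show "t i ^ c i / (of_nat i ^ c i * fact (c i)) = 1" by simp
  qed (use that in auto)
  have step: "(\<Sum>c\<in>cycle_types k. of_nat (j * c j) * (\<Prod>i = 1..k. w i (c i)))
      = t j * cycle_sum t (k - j)" if j: "j \<in> {1..k}" for j
  proof -
    \<comment> \<open>Types with \<open>c j = 0\<close> carry the factor 0. Without them,
      decrementing \<open>c j\<close> is a bijection onto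
      \<open>cycle_types (k - j)\<close>.\<close>
    have "(\<Sum>c\<in>cycle_types k. of_nat (j * c j) * (\<Prod>i = 1..k. w i (c i)))
        = (\<Sum>c\<in>{c \<in> cycle_types k. c j \<noteq> 0}. of_nat (j * c j) * (\<Prod>i = 1..k. w i (c i)))"
      by (rule sum.mono_neutral_right) (auto simp: finite_cycle_types)
    also have "\<dots> = (\<Sum>d\<in>cycle_types (k - j). t j * (\<Prod>i = 1..k. w i (d i)))"
    proof (rule sum.reindex_bij_witness[where i = "\<lambda>d. d(j := Suc (d j))" and j = "\<lambda>c. c(j := c j - 1)"])
      fix c assume c: "c \<in> {c \<in> cycle_types k. c j \<noteq> 0}"
      then show "(c(j := c j - 1))(j := Suc ((c(j := c j - 1)) j)) = c" by auto
      have ck: "(\<Sum>i = 1..k. i * c i) = k" and supp: "\<forall>i. i \<notin> {1..k} \<longrightarrow> c i = 0"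
        using c by (auto simp: cycle_types_def)
      have "(\<Sum>i = 1..k. i * c i) = j * c j + (\<Sum>i\<in>{1..k} - {j}. i * c i)"
        by (rule sum.remove) (use j in auto)
      moreover have "(\<Sum>i = 1..k. i * (c(j := c j - 1)) i)
          = j * (c j - 1) + (\<Sum>i\<in>{1..k} - {j}. i * (c(j := c j - 1)) i)"
        by (subst sum.remove[of _ j]) (use j in auto)
      moreover have "(\<Sum>i\<in>{1..k} - {j}. i * (c(j := c j - 1)) i) = (\<Sum>i\<in>{1..k} - {j}. i * c i)"
        by (rule sum.cong) auto
      moreover have "j * c j = j * (c j - 1) + j"
        using c by (cases "c j") auto
      ultimately have "(\<Sum>i = 1..k. i * (c(j := c j - 1)) i) = k - j"
        using ck by linarith
      with supp j show "c(j := c j - 1) \<in> cycle_types (k - j)"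
        by (subst cycle_types_alt[of "k - j" k]) auto
      have "(\<Prod>i = 1..k. w i (c i)) = w j (c j) * (\<Prod>i\<in>{1..k} - {j}. w i (c i))"
        by (rule prod.remove) (use j in auto)
      moreover have "(\<Prod>i = 1..k. w i ((c(j := c j - 1)) i))
          = w j (c j - 1) * (\<Prod>i\<in>{1..k} - {j}. w i ((c(j := c j - 1)) i))"
        by (subst prod.remove[of _ j]) (use j in auto)
      moreover have "(\<Prod>i\<in>{1..k} - {j}. w i ((c(j := c j - 1)) i)) = (\<Prod>i\<in>{1..k} - {j}. w i (c i))"
        by (rule prod.cong) auto
      moreover have "of_nat (j * c j) * w j (c j) = t j * w j (c j - 1)"
        using w_Suc[of j "c j - 1"] c j by simp
      ultimately show "t j * (\<Prod>i = 1..k. w i ((c(j := c j - 1)) i))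
          = of_nat (j * c j) * (\<Prod>i = 1..k. w i (c i))"
        by (simp add: mult.assoc [symmetric])
    next
      fix d assume d: "d \<in> cycle_types (k - j)"
      then show "(d(j := Suc (d j)))(j := (d(j := Suc (d j))) j - 1) = d" by auto
      have dk: "(\<Sum>i = 1..k. i * d i) = k - j" and supp: "\<forall>i. i \<notin> {1..k} \<longrightarrow> d i = 0"
        using d by (auto simp: cycle_types_alt[of "k - j" k])
      have "(\<Sum>i = 1..k. i * d i) = j * d j + (\<Sum>i\<in>{1..k} - {j}. i * d i)"
        by (rule sum.remove) (use j in auto)
      moreover have "(\<Sum>i = 1..k. i * (d(j := Suc (d j))) i)
          = j * Suc (d j) + (\<Sum>i\<in>{1..k} - {j}. i * (d(j := Suc (d j))) i)"
        by (subst sum.remove[of _ j]) (use j in auto)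
      moreover have "(\<Sum>i\<in>{1..k} - {j}. i * (d(j := Suc (d j))) i) = (\<Sum>i\<in>{1..k} - {j}. i * d i)"
        by (rule sum.cong) auto
      ultimately have "(\<Sum>i = 1..k. i * (d(j := Suc (d j))) i) = k"
        using dk j by (simp only: mult_Suc_right) auto
      with supp j show "d(j := Suc (d j)) \<in> {c \<in> cycle_types k. c j \<noteq> 0}"
        by (auto simp: cycle_types_def)
    qed
    finally show ?thesis
      using j by (simp add: cs sum_distrib_left)
  qed
  have "of_nat k * cycle_sum t k
      = (\<Sum>c\<in>cycle_types k. of_nat k * (\<Prod>i = 1..k. w i (c i)))"
    by (simp add: cs sum_distrib_left)
  \<comment> \<open>On each type the factor \<open>k\<close> equals the sum of all
    \<open>j * c j\<close>, which splits the total by the length of the removed cycle.\<close>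
  also have "\<dots> = (\<Sum>c\<in>cycle_types k. of_nat (\<Sum>j = 1..k. j * c j) * (\<Prod>i = 1..k. w i (c i)))"
    by (rule sum.cong) (auto simp: cycle_types_def)
  also have "\<dots> = (\<Sum>c\<in>cycle_types k. \<Sum>j = 1..k. of_nat (j * c j) * (\<Prod>i = 1..k. w i (c i)))"
    by (simp add: sum_distrib_right)
  also have "\<dots> = (\<Sum>j = 1..k. \<Sum>c\<in>cycle_types k. of_nat (j * c j) * (\<Prod>i = 1..k. w i (c i)))"
    by (rule sum.swap)
  also have "\<dots> = (\<Sum>j = 1..k. t j * cycle_sum t (k - j))"
    by (intro sum.cong refl step)
  finally show ?thesis .
qed

section \<open>Elementary symmetric functions and Newton's identities\<close>

definition elem_sym :: "('b \<Rightarrow> complex) \<Rightarrow> 'b set \<Rightarrow> nat \<Rightarrow> complex" where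
  "elem_sym x A k = (\<Sum>S | S \<subseteq> A \<and> card S = k. \<Prod>a\<in>S. x a)"

text \<open>Expanding the product, each subset \<open>S\<close> contributes the product of the
  \<open>- x a\<close> over \<open>S\<close> times \<open>fps_X ^ card S\<close>.\<close>

lemma fps_nth_prod_one_minus:
  assumes "finite A"
  shows "fps_nth (\<Prod>a\<in>A. 1 - fps_const (x a) * fps_X) k = (-1) ^ k * elem_sym x A k"
proof -
  have "(\<Prod>a\<in>A. 1 - fps_const (x a) * fps_X) = (\<Prod>a\<in>A. fps_const (- x a) * fps_X + 1)"
    by (intro prod.cong refl) (simp flip: fps_const_neg)
  also have "\<dots> = (\<Sum>S\<in>Pow A. \<Prod>a\<in>S. fps_const (- x a) * fps_X)"
    using assms by (subst prod_add) simp_all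
  also have "\<dots> = (\<Sum>S\<in>Pow A. fps_const (\<Prod>a\<in>S. - x a) * fps_X ^ card S)"
  proof (rule sum.cong)
    fix S
    have "(\<Prod>a\<in>S. fps_const (- x a)) = fps_const (\<Prod>a\<in>S. - x a)"
      by (induction S rule: infinite_finite_induct) simp_all
    then show "(\<Prod>a\<in>S. fps_const (- x a) * fps_X) = fps_const (\<Prod>a\<in>S. - x a) * fps_X ^ card S"
      by (simp only: prod.distrib prod_constant)
  qed simp
  finally have "fps_nth (\<Prod>a\<in>A. 1 - fps_const (x a) * fps_X) k
      = (\<Sum>S\<in>Pow A. if card S = k then \<Prod>a\<in>S. - x a else 0)"
    by (simp add: fps_sum_nth) (auto intro!: sum.cong)
  also have "\<dots> = (\<Sum>S | S \<subseteq> A \<and> card S = k. \<Prod>a\<in>S. - x a)"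
    using assms by (simp add: sum.If_cases Pow_def) (auto intro!: sum.cong)
  also have "\<dots> = (-1) ^ k * elem_sym x A k"
    unfolding elem_sym_def sum_distrib_left by (intro sum.cong refl) (auto simp: prod_uminus)
  finally show ?thesis .
qed

text \<open>Newton's identities in generating-function form.\<close>
lemma fps_deriv_prod_one_minus:
  fixes x :: "'b \<Rightarrow> complex"
  assumes "finite A"
  defines "F \<equiv> \<lambda>A. \<Prod>a\<in>A. 1 - fps_const (x a) * fps_X"
  shows "fps_X * fps_deriv (F A)
    = F A * Abs_fps (\<lambda>j. if j = 0 then 0 else - (\<Sum>a\<in>A. x a ^ j))"
  using assms(1)
proof (induction A)
  case empty
  have "Abs_fps (\<lambda>j. if j = 0 then 0 else - (\<Sum>a\<in>{}. x a ^ j)) = 0"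
    by (rule fps_ext) simp
  then show ?case by (simp add: F_def)
next
  case (insert b B)
  \<comment> \<open>\<open>T\<close> is X times the logarithmic derivative of the product. It is
    additive over disjoint sets, so the induction reduces to a single factor.\<close>
  define T where "T = (\<lambda>B. Abs_fps (\<lambda>j. if j = 0 then 0 else - (\<Sum>a\<in>B. x a ^ j)))"
  let ?L = "1 - fps_const (x b) * fps_X :: complex fps"
  have F: "F (insert b B) = ?L * F B"
    using insert by (simp add: F_def)
  have T: "T (insert b B) = T {b} + T B"
    using insert by (intro fps_ext) (simp add: T_def)
  \<comment> \<open>\<open>T {b}\<close> is the geometric series for
    \<open>- x b * X / (1 - x b * X)\<close>; multiplying by \<open>?L\<close> clears the
    denominator.\<close>
  have L: "?L * T {b} = fps_X * fps_deriv ?L"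
  proof (rule fps_ext)
    fix n
    show "fps_nth (?L * T {b}) n = fps_nth (fps_X * fps_deriv ?L) n"
      by (cases n) (auto simp: left_diff_distrib mult.assoc T_def power_eq_if)
  qed
  have "fps_X * fps_deriv (F (insert b B))
      = fps_X * fps_deriv ?L * F B + ?L * (fps_X * fps_deriv (F B))"
    unfolding F fps_deriv_mult by (simp only: ring_distribs ac_simps)
  also have "\<dots> = ?L * T {b} * F B + ?L * (F B * T B)"
    using insert.IH L by (simp only: T_def)
  also have "\<dots> = F (insert b B) * T (insert b B)"
    unfolding F T by (simp only: distrib_left ac_simps)
  finally show ?case by (simp only: T_def)
qed

text \<open>The coefficients of the product over \<open>A\<close> satisfy the recursion
  \<open>cycle_sum_rec\<close> with \<open>t j\<close> the negated power sums, and both sequences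
  start with 1. As \<open>n\<close> is invertible for \<open>n > 0\<close>, they coincide; the sign
  comes from \<open>fps_nth_prod_one_minus\<close>.\<close>

lemma elem_sym_eq_cycle_sum:
  assumes "finite A"
  shows "elem_sym x A k = (-1) ^ k * cycle_sum (\<lambda>j. - (\<Sum>a\<in>A. x a ^ j)) k"
proof -
  define t where "t = (\<lambda>j. - (\<Sum>a\<in>A. x a ^ j))"
  define F where "F = (\<Prod>a\<in>A. 1 - fps_const (x a) * fps_X)"
  have rec: "of_nat n * fps_nth F n = (\<Sum>j = 1..n. t j * fps_nth F (n - j))" for n
  proof -
    have "of_nat n * fps_nth F n = fps_nth (fps_X * fps_deriv F) n"
      by (cases n) (auto simp: fps_deriv_nth)
    also have "\<dots> = fps_nth (Abs_fps (\<lambda>j. if j = 0 then 0 else t j) * F) n"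
      using fps_deriv_prod_one_minus[OF assms, of x] unfolding F_def t_def by (subst (2) mult.commute) simp
    also have "\<dots> = (\<Sum>j = 0..n. (if j = 0 then 0 else t j) * fps_nth F (n - j))"
      by (simp add: fps_mult_nth)
    also have "\<dots> = (\<Sum>j = 1..n. t j * fps_nth F (n - j))"
      by (rule sum.mono_neutral_cong_right) auto
    finally show ?thesis .
  qed
  have F_eq: "fps_nth F n = cycle_sum t n" for n
  proof (induction n rule: less_induct)
    case (less n)
    show ?case
    proof (cases "n = 0")
      case True
      have "{S. S \<subseteq> A \<and> card S = 0} = {{}}"
        using assms by (auto simp: card_eq_0_iff dest: finite_subset)
      then have "fps_nth F 0 = 1"
        by (simp only: F_def fps_nth_prod_one_minus[OF assms] elem_sym_def) simp
      with True show ?thesis by (simp add: cycle_sum_0)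
    next
      case False
      have "of_nat n * fps_nth F n = of_nat n * cycle_sum t n"
        unfolding rec cycle_sum_rec by (intro sum.cong refl) (use less in auto)
      with False show ?thesis by simp
    qed
  qed
  have "(-1) ^ k * elem_sym x A k = cycle_sum t k"
    using F_eq[of k] by (simp add: F_def fps_nth_prod_one_minus[OF assms])
  then have "(-1) ^ k * ((-1) ^ k * elem_sym x A k) = (-1) ^ k * cycle_sum t k"
    by simp
  then show ?thesis
    by (simp add: t_def mult.assoc [symmetric] flip: power_add)
qed

section \<open>Additive characters of finite fields\<close>

text \<open>Multiplication by \<open>x\<close> permutes the nonzero elements, so it leaves their
  product unchanged while scaling it by \<open>x ^ (CARD('a) - 1)\<close>.\<close>

lemma finite_field_power_card_minus_1:
  fixes x :: "'a::{field,finite}"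
  assumes "x \<noteq> 0"
  shows "x ^ (CARD('a) - 1) = 1"
proof -
  let ?P = "\<Prod>y\<in>UNIV - {0::'a}. y"
  have "?P = (\<Prod>y\<in>UNIV - {0::'a}. x * y)"
    by (rule prod.reindex_bij_witness[where i = "\<lambda>y. x * y" and j = "\<lambda>y. y / x"])
       (use assms in auto)
  also have "\<dots> = x ^ (CARD('a) - 1) * ?P"
    by (simp add: prod.distrib)
  finally show ?thesis by simp
qed

lemma finite_field_power_card:
  fixes x :: "'a::{field,finite}"
  shows "x ^ CARD('a) = x"
proof (cases "x = 0")
  case False
  have "CARD('a) = Suc (CARD('a) - 1)" by simp
  then have "x ^ CARD('a) = x * x ^ (CARD('a) - 1)" by (metis power_Suc)
  with finite_field_power_card_minus_1[OF False] show ?thesis by simp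
qed simp

lemma CHAR_eq_if_card_prime_power:
  assumes "prime p" "CARD('a::{field,finite}) = p ^ s"
  shows "CHAR('a) = p"
proof -
  have "CHAR('a) > 0" by (rule finite_imp_CHAR_pos) simp
  then have "prime CHAR('a)" by (rule prime_CHAR_semidom)
  moreover have "CHAR('a) dvd p ^ s"
    using CHAR_dvd_CARD[where 'a='a] assms by simp
  ultimately show ?thesis
    using assms by (metis prime_dvd_power primes_dvd_imp_eq)
qed

text \<open>The polynomial \<open>X^p - X\<close> has at most \<open>p\<close> roots, and the
  \<open>p\<close> distinct elements \<open>of_nat n\<close> with \<open>n < p\<close> are already
  roots, so there are no others.\<close>

lemma power_CHAR_eq_imp_of_nat:
  fixes x :: "'a::{field,finite}"
  assumes "x ^ CHAR('a) = x"
  obtains n where "x = of_nat n"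
proof -
  define p where "p = CHAR('a)"
  have pr: "prime p"
    unfolding p_def by (rule prime_CHAR_semidom, rule finite_imp_CHAR_pos) simp
  then have p2: "p \<ge> 2" by (rule prime_ge_2_nat)
  define P :: "'a poly" where "P = monom 1 p - monom 1 1"
  have "coeff P p = 1" using p2 by (simp add: P_def)
  then have "P \<noteq> 0" by auto
  have "degree P \<le> p"
    unfolding P_def by (rule degree_diff_le) (use p2 in \<open>auto simp: degree_monom_eq\<close>)
  have "{y. poly P y = 0} = {y. y ^ p = y}"
    by (simp add: P_def poly_monom)
  then have "card {y::'a. y ^ p = y} \<le> p"
    using card_poly_roots_bound[OF \<open>P \<noteq> 0\<close>] \<open>degree P \<le> p\<close> by simp
  moreover have "(of_nat n :: 'a) ^ p = of_nat n" for n
    by (induction n) (use pr p_def in \<open>auto simp: freshmans_dream power_0_left\<close>)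
  then have "of_nat ` {..<p} \<subseteq> {y::'a. y ^ p = y}" by auto
  moreover have "card (of_nat ` {..<p} :: 'a set) = p"
    by (subst card_image) (auto intro!: inj_onI simp: of_nat_eq_iff_cong_CHAR p_def cong_def)
  ultimately have "of_nat ` {..<p} = {y::'a. y ^ p = y}"
    by (intro card_seteq) auto
  with assms that show ?thesis by (auto simp: p_def)
qed

text \<open>The axiom \<open>zero\<close> excludes the zero function, which satisfies the other
  two.\<close>

locale nontrivial_additive_char =
  fixes \<psi> :: "'a::{field,finite} \<Rightarrow> complex"
  assumes add: "\<psi> (x + y) = \<psi> x * \<psi> y"
    and zero: "\<psi> 0 = 1"
    and nontrivial: "\<exists>x. \<psi> x \<noteq> 1"

text \<open>The character is $x \mapsto e^{2\pi i \mathrm{Tr}(x)/p}$; the trace is nonzero because as a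
  polynomial it has degree $p^{s-1} < q$.\<close>
lemma ex_nontrivial_additive_char:
  assumes p: "prime p" and card: "CARD('a::{field,finite}) = p ^ s" and s: "s \<ge> 1"
  shows "\<exists>\<psi> :: 'a \<Rightarrow> complex. nontrivial_additive_char \<psi>"
proof -
  have char: "CHAR('a) = p" by (rule CHAR_eq_if_card_prime_power) fact+
  have p2: "p \<ge> 2" using p by (rule prime_ge_2_nat)
  \<comment> \<open>The trace to the prime field, as the sum of the Frobenius conjugates.\<close>
  define T :: "'a \<Rightarrow> 'a" where "T = (\<lambda>x. \<Sum>i<s. x ^ (p ^ i))"
  have T_add: "T (x + y) = T x + T y" for x y
    unfolding T_def sum.distrib [symmetric]
    by (intro sum.cong refl freshmans_dream') (use p char in auto)
  \<comment> \<open>Frobenius shifts the summands cyclically: the last one becomes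
    \<open>x ^ (p ^ s)\<close>, which equals \<open>x\<close>. Hence the trace lies in the prime
    field.\<close>
  have T_pow: "T x ^ p = T x" for x
  proof -
    obtain m where m: "s = Suc m" using s by (cases s) auto
    have "T x ^ p = (\<Sum>i<s. (x ^ (p ^ i)) ^ p)"
      unfolding T_def by (rule freshmans_dream_sum) (use p char in auto)
    also have "\<dots> = (\<Sum>i<s. x ^ (p ^ Suc i))"
      by (simp add: power_mult [symmetric] mult.commute)
    also have "\<dots> = (\<Sum>i<m. x ^ (p ^ Suc i)) + x ^ (p ^ s)"
      by (simp add: m)
    also have "x ^ (p ^ s) = x ^ (p ^ 0)"
      using finite_field_power_card[of x] card by simp
    also have "(\<Sum>i<m. x ^ (p ^ Suc i)) + x ^ (p ^ 0) = T x"
      unfolding T_def m by (subst sum.lessThan_Suc_shift) (simp add: add.commute)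
    finally show ?thesis .
  qed
  have "\<exists>n. T x = of_nat n" for x
    using power_CHAR_eq_imp_of_nat[of "T x"] T_pow char by metis
  then obtain f where f: "\<And>x. T x = of_nat (f x)" by metis
  define \<omega> where "\<omega> = cis (2 * pi / p)"
  have \<omega>_p: "\<omega> ^ p = 1"
    using p2 by (simp add: \<omega>_def Complex.DeMoivre)
  have \<omega>_mod: "\<omega> ^ n = \<omega> ^ (n mod p)" for n
  proof -
    have "\<omega> ^ n = \<omega> ^ (p * (n div p) + n mod p)" by simp
    also have "\<dots> = \<omega> ^ (n mod p)"
      unfolding power_add power_mult \<omega>_p by simp
    finally show ?thesis .
  qed
  \<comment> \<open>Powers of \<open>\<omega>\<close> depend on the exponent only modulo
    \<open>p\<close>, so the choice of the representatives \<open>f x\<close> is immaterial.\<close>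
  have \<omega>_cong: "\<omega> ^ m = \<omega> ^ n" if "of_nat m = (of_nat n :: 'a)" for m n
    using that \<omega>_mod[of m] \<omega>_mod[of n] by (simp add: of_nat_eq_iff_cong_CHAR char cong_def)
  \<comment> \<open>\<open>\<omega>\<close> has exact order \<open>p\<close>, so a nonzero trace
    value gives a character value different from 1.\<close>
  have \<omega>_1: "p dvd n" if "\<omega> ^ n = 1" for n
  proof -
    have "cos (real n * (2 * pi / p)) = 1"
      using that by (simp add: \<omega>_def Complex.DeMoivre complex_eq_iff)
    then obtain k :: int where "real n * (2 * pi / p) = of_int k * 2 * pi"
      using cos_one_2pi_int by blast
    then have "real_of_int (int n) = real_of_int (k * int p)" using p2 by (simp add: field_simps)
    then have "int n = k * int p" by (simp only: of_int_eq_iff)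
    then have "int p dvd int n" by simp
    then show ?thesis by simp
  qed
  have "\<exists>x. T x \<noteq> 0"
  proof (rule ccontr)
    assume "\<not> ?thesis"
    then have T0: "\<And>x. T x = 0" by auto
    define P :: "'a poly" where "P = (\<Sum>i<s. monom 1 (p ^ i))"
    have "poly P x = 0" for x
      using T0[of x] by (simp add: P_def T_def poly_sum poly_monom)
    then have roots: "{x. poly P x = 0} = UNIV" by auto
    \<comment> \<open>Only \<open>i = 0\<close> contributes to the linear coefficient, since
      \<open>p ^ i > 1\<close> for \<open>i > 0\<close>; so \<open>P\<close> is not the zero
      polynomial.\<close>
    have "coeff P 1 = (\<Sum>i<s. if i = 0 then 1 else 0)"
      unfolding P_def coeff_sum by (intro sum.cong) (use p2 in auto)
    also have "\<dots> = 1" using s by simp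
    finally have "P \<noteq> 0" by auto
    moreover have "degree P \<le> p ^ (s - 1)"
      unfolding P_def
      by (intro degree_sum_le) (use p2 in \<open>auto simp: degree_monom_eq intro!: power_increasing\<close>)
    ultimately have "p ^ s \<le> p ^ (s - 1)"
      using card_poly_roots_bound[of P] roots card by simp
    moreover have "p ^ (s - 1) < p ^ s"
      by (rule power_strict_increasing) (use p2 s in auto)
    ultimately show False by simp
  qed
  then obtain x where x: "T x \<noteq> 0" ..
  show ?thesis
  proof (intro exI[of _ "\<lambda>x. \<omega> ^ f x"], unfold_locales)
    fix x y
    have "of_nat (f (x + y)) = (of_nat (f x + f y) :: 'a)"
      using T_add[of x y] by (simp add: f)
    then show "\<omega> ^ f (x + y) = \<omega> ^ f x * \<omega> ^ f y"
      by (metis \<omega>_cong power_add)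
  next
    have "T 0 = 0" using p2 by (simp add: T_def power_0_left)
    then show "\<omega> ^ f 0 = 1"
      using \<omega>_cong[of "f 0" 0] f[of 0] by simp
  next
    have "\<omega> ^ f x \<noteq> 1"
      using \<omega>_1[of "f x"] x f[of x] by (auto simp: of_nat_eq_0_iff_char_dvd char)
    then show "\<exists>x. \<omega> ^ f x \<noteq> 1" ..
  qed
qed

section \<open>The quadratic character\<close>

text \<open>Squaring is two-to-one on the nonzero elements.\<close>
lemma card_nonzero_squares:
  assumes "(2::'a::{field,finite}) \<noteq> 0"
  shows "2 * card (nonzero_squares :: 'a set) = CARD('a) - 1"
proof -
  have "CARD('a) - 1 = card (UNIV - {0::'a})" by simp
  also have "\<dots> = card (\<Union>y\<in>nonzero_squares. {x::'a. x ^ 2 = y})"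
    by (rule arg_cong[where f = card]) (auto simp: nonzero_squares_def)
  also have "\<dots> = (\<Sum>y\<in>nonzero_squares. card {x::'a. x ^ 2 = y})"
    by (rule card_UN_disjoint) auto
  also have "\<dots> = (\<Sum>y\<in>(nonzero_squares :: 'a set). 2)"
  proof (rule sum.cong)
    fix y :: 'a assume "y \<in> nonzero_squares"
    then obtain z where z: "y = z ^ 2" "z \<noteq> 0" by (auto simp: nonzero_squares_def)
    have "{x. x ^ 2 = y} = {z, - z}" unfolding z by (auto simp: power2_eq_iff)
    moreover have "z \<noteq> - z"
    proof
      assume "z = - z"
      then have "2 * z = 0" by (simp only: eq_neg_iff_add_eq_0 mult_2)
      with assms z show False by simp
    qed
    ultimately show "card {x. x ^ 2 = y} = 2" by simp
  qed simp
  finally show ?thesis by simp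
qed

text \<open>With \<open>h = (q - 1) / 2\<close>, the \<open>h\<close> nonzero squares are roots of
  \<open>X^h - 1\<close> and hence all of its roots. Any other nonzero \<open>x\<close> has
  \<open>(x ^ h)^2 = 1\<close>, which leaves \<open>x ^ h = -1\<close>. At 0 both sides vanish
  because \<open>h > 0\<close>.\<close>

lemma euler_criterion:
  fixes x :: "'a::{field,finite}"
  assumes "(2::'a) \<noteq> 0"
  shows "of_int (quad_char x) = x ^ card (nonzero_squares :: 'a set)"
proof -
  define h where "h = card (nonzero_squares :: 'a set)"
  have h: "2 * h = CARD('a) - 1"
    unfolding h_def using assms by (rule card_nonzero_squares)
  have "(1::'a) \<in> nonzero_squares" 
    unfolding nonzero_squares_def by (intro CollectI exI[of _ 1]) simp
  then have h0: "h > 0" unfolding h_def by (auto simp: card_gt_0_iff)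
  define P :: "'a poly" where "P = monom 1 h - 1"
  have "coeff P h = 1" using h0 by (simp add: P_def)
  then have "P \<noteq> 0" by auto
  have "degree P \<le> h"
    unfolding P_def by (rule degree_diff_le) (use h0 in \<open>auto simp: degree_monom_eq\<close>)
  have "{y. poly P y = 0} = {y. y ^ h = 1}"
    by (simp add: P_def poly_monom)
  then have "card {y::'a. y ^ h = 1} \<le> h"
    using card_poly_roots_bound[OF \<open>P \<noteq> 0\<close>] \<open>degree P \<le> h\<close> by simp
  moreover have "nonzero_squares \<subseteq> {y::'a. y ^ h = 1}"
    by (auto simp: nonzero_squares_def power_mult [symmetric] h finite_field_power_card_minus_1[unfolded One_nat_def])
  ultimately have sq: "nonzero_squares = {y::'a. y ^ h = 1}"
    by (intro card_seteq) (auto simp: h_def)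
  show ?thesis
  proof (cases "x = 0")
    case True
    with h0 show ?thesis by (simp add: quad_char_def h_def)
  next
    case False
    then have "(x ^ h) ^ 2 = 1"
      by (simp add: power_even_eq [symmetric] h finite_field_power_card_minus_1[unfolded One_nat_def])
    then have "x ^ h = 1 \<or> x ^ h = -1" by (simp add: power2_eq_1_iff)
    with False show ?thesis
      unfolding h_def [symmetric] by (auto simp: quad_char_def sq)
  qed
qed

text \<open>Euler's criterion yields equations in the field only; in odd characteristic -1, 0 and 1
  stay distinct there, so such equations lift back to the integers.\<close>

lemma of_int_eq_iff_sign:
  assumes "(2::'a::field) \<noteq> 0" "a \<in> {-1, 0, 1}" "b \<in> {-1, 0, 1}"
  shows "of_int a = (of_int b :: 'a) \<longleftrightarrow> a = b"
proof -
  have "(1::'a) \<noteq> -1" using assms(1) by (simp add: eq_neg_iff_add_eq_0)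
  with assms(2,3) show ?thesis by auto
qed

lemma quad_char_range: "quad_char x \<in> {-1, 0, 1}"
  by (simp add: quad_char_def)

lemma quad_char_eq_0_iff [simp]: "quad_char x = 0 \<longleftrightarrow> x = 0"
  by (simp add: quad_char_def)

lemma quad_char_square: "x \<noteq> 0 \<Longrightarrow> quad_char x * quad_char x = 1"
  by (simp add: quad_char_def)

lemma nonzero_squares_eq: "nonzero_squares = {x. quad_char x = 1}"
  by (auto simp: quad_char_def nonzero_squares_def)

text \<open>By Euler's criterion the character is a power map, which is multiplicative.\<close>

lemma quad_char_mult:
  fixes x y :: "'a::{field,finite}"
  assumes "(2::'a) \<noteq> 0"
  shows "quad_char (x * y) = quad_char x * quad_char y"
proof -
  have "quad_char x * quad_char y \<in> {-1, 0, 1}"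
    using quad_char_range[of x] quad_char_range[of y] by auto
  moreover have "of_int (quad_char (x * y)) = (of_int (quad_char x * quad_char y) :: 'a)"
    by (simp add: euler_criterion[OF assms] power_mult_distrib)
  ultimately show ?thesis
    using of_int_eq_iff_sign[OF assms quad_char_range] by blast
qed

lemma quad_char_minus_1:
  assumes "(2::'a::{field,finite}) \<noteq> 0"
  shows "quad_char (-1 :: 'a) = (-1) ^ card (nonzero_squares :: 'a set)"
proof -
  have "(-1) ^ card (nonzero_squares :: 'a set) \<in> {-1, 0, 1::int}"
    by (cases "even (card (nonzero_squares :: 'a set))") auto
  moreover have "of_int (quad_char (-1 :: 'a)) = (of_int ((-1) ^ card (nonzero_squares :: 'a set)) :: 'a)"
    by (simp add: euler_criterion[OF assms])
  ultimately show ?thesis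
    using of_int_eq_iff_sign[OF assms quad_char_range] by blast
qed

text \<open>Exactly half of the nonzero elements are squares.\<close>

lemma sum_quad_char:
  assumes "(2::'a::{field,finite}) \<noteq> 0"
  shows "(\<Sum>x\<in>UNIV. quad_char (x::'a)) = 0"
proof -
  have "0 \<notin> (nonzero_squares :: 'a set)"
    by (auto simp: nonzero_squares_def)
  then have card: "card (UNIV - {0::'a} - nonzero_squares) = card (nonzero_squares :: 'a set)"
    using card_nonzero_squares[OF assms] by (subst card_Diff_subset) auto
  have "(\<Sum>x\<in>UNIV. quad_char (x::'a)) = (\<Sum>x\<in>UNIV - {0::'a}. if x \<in> nonzero_squares then 1 else -1)"
    by (rule sum.mono_neutral_cong_right) (auto simp: quad_char_def)
  also have "\<dots> = (\<Sum>x\<in>(nonzero_squares :: 'a set). 1) + (\<Sum>x\<in>UNIV - {0::'a} - nonzero_squares. -1)"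
  proof -
    have "(UNIV - {0::'a}) \<inter> {x. x \<in> nonzero_squares} = nonzero_squares"
      using \<open>0 \<notin> nonzero_squares\<close> by auto
    then show ?thesis by (subst sum.If_cases) (simp_all add: Diff_eq)
  qed
  also have "\<dots> = 0" using card by simp
  finally show ?thesis .
qed

section \<open>Gauss sums and subset sums\<close>

locale odd_additive_char = nontrivial_additive_char \<psi> for \<psi> :: "'a::{field,finite} \<Rightarrow> complex" +
  assumes two_neq_0: "(2::'a) \<noteq> 0"
begin

lemma char_of_nat_mult: "\<psi> (of_nat n * x) = \<psi> x ^ n"
  by (induction n) (simp_all add: zero add distrib_right)

lemma char_sum: "finite S \<Longrightarrow> \<psi> (\<Sum>x\<in>S. f x) = (\<Prod>x\<in>S. \<psi> (f x))"
  by (induction S rule: finite_induct) (simp_all add: zero add)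

text \<open>Translation by \<open>a\<close> with \<open>\<psi> a \<noteq> 1\<close> permutes the
  field and multiplies the sum by \<open>\<psi> a\<close>.\<close>

lemma sum_UNIV: "(\<Sum>x\<in>UNIV. \<psi> x) = 0"
proof -
  obtain a where a: "\<psi> a \<noteq> 1" using nontrivial by blast
  have "(\<Sum>x\<in>UNIV. \<psi> x) = (\<Sum>x\<in>UNIV. \<psi> (a + x))"
    by (rule sum.reindex_bij_witness[where i = "\<lambda>x. a + x" and j = "\<lambda>x. x - a"]) auto
  also have "\<dots> = \<psi> a * (\<Sum>x\<in>UNIV. \<psi> x)"
    by (simp add: add sum_distrib_left)
  finally show ?thesis using a by simp
qed

lemma sum_UNIV_mult: "(\<Sum>x\<in>UNIV. \<psi> (x * c)) = (if c = 0 then of_nat CARD('a) else 0)"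
proof (cases "c = 0")
  case False
  have "(\<Sum>x\<in>UNIV. \<psi> (x * c)) = (\<Sum>x\<in>UNIV. \<psi> x)"
    by (rule sum.reindex_bij_witness[where i = "\<lambda>x. x / c" and j = "\<lambda>x. x * c"])
       (use False in auto)
  with False show ?thesis by (simp add: sum_UNIV)
qed (simp add: zero)

definition gauss_sum :: complex where
  "gauss_sum = (\<Sum>x\<in>UNIV. of_int (quad_char x) * \<psi> x)"

text \<open>For \<open>c \<noteq> 0\<close>, substitute \<open>c * x\<close> for \<open>x\<close>
  and use \<open>quad_char_square\<close>. For \<open>c = 0\<close> both sides vanish, the left one
  by \<open>sum_quad_char\<close>.\<close>

lemma twisted_gauss_sum:
  "(\<Sum>x\<in>UNIV. of_int (quad_char x) * \<psi> (c * x)) = of_int (quad_char c) * gauss_sum"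
proof (cases "c = 0")
  case True
  have "(\<Sum>x\<in>UNIV. of_int (quad_char (x::'a))) = (0::complex)"
    unfolding of_int_sum [symmetric] sum_quad_char[OF two_neq_0] by simp
  with True show ?thesis by (simp add: zero quad_char_def)
next
  case False
  have "of_int (quad_char c) * gauss_sum
      = (\<Sum>x\<in>UNIV. of_int (quad_char c) * of_int (quad_char x) * \<psi> x)"
    by (simp add: gauss_sum_def sum_distrib_left mult.assoc)
  also have "\<dots> = (\<Sum>x\<in>UNIV. of_int (quad_char c * quad_char (c * x)) * \<psi> (c * x))"
    by (rule sum.reindex_bij_witness[where i = "\<lambda>x. c * x" and j = "\<lambda>x. x / c"])
       (use False in auto)
  also have "\<dots> = (\<Sum>x\<in>UNIV. of_int (quad_char x) * \<psi> (c * x))"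
    by (simp only: quad_char_mult[OF two_neq_0] mult.assoc [symmetric] quad_char_square[OF False]) simp
  finally show ?thesis by simp
qed

text \<open>One factor is absorbed as a twisted sum, which is valid at \<open>x = 0\<close> too, so
  that \<open>x\<close> runs over the whole field. Summing over \<open>x\<close> first,
  orthogonality then leaves only \<open>y = -1\<close>.\<close>

lemma gauss_sum_square: "gauss_sum ^ 2 = of_int (quad_char (-1::'a)) * of_nat CARD('a)"
proof -
  have "gauss_sum ^ 2 = (\<Sum>x\<in>UNIV. \<psi> x * (of_int (quad_char x) * gauss_sum))"
    by (simp add: power2_eq_square gauss_sum_def [symmetric] sum_distrib_right [symmetric] ac_simps)
       (simp add: gauss_sum_def sum_distrib_left ac_simps)
  also have "\<dots> = (\<Sum>x\<in>UNIV. \<Sum>y\<in>UNIV. \<psi> x * (of_int (quad_char y) * \<psi> (x * y)))"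
    by (simp only: twisted_gauss_sum [symmetric] sum_distrib_left)
  also have "\<dots> = (\<Sum>y\<in>UNIV. \<Sum>x\<in>UNIV. \<psi> x * (of_int (quad_char y) * \<psi> (x * y)))"
    by (rule sum.swap)
  also have "\<dots> = (\<Sum>y\<in>UNIV. of_int (quad_char y) * (\<Sum>x\<in>UNIV. \<psi> (x * (1 + y))))"
    by (simp add: sum_distrib_left distrib_left add ac_simps)
  also have "\<dots> = (\<Sum>y\<in>UNIV. if y = (-1::'a) then of_int (quad_char y) * of_nat CARD('a) else 0)"
    unfolding sum_UNIV_mult by (rule sum.cong) (auto simp: eq_neg_iff_add_eq_0 Groups.add.commute)
  also have "\<dots> = of_int (quad_char (-1::'a)) * of_nat CARD('a)"
    by simp
  finally show ?thesis .
qed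

text \<open>On nonzero \<open>x\<close> the weight \<open>1 + \<epsilon> * quad_char x\<close> is
  twice the indicator of the class. At \<open>x = 0\<close> it is 1, which accounts for the
  \<open>- 1\<close> in the numerator.\<close>

lemma sum_quad_class:
  assumes "c \<noteq> 0" "\<epsilon> \<in> {-1, 1}"
  shows "(\<Sum>x | quad_char x = \<epsilon>. \<psi> (c * x))
    = (of_int (\<epsilon> * quad_char c) * gauss_sum - 1) / 2"
proof -
  have "of_int (\<epsilon> * quad_char c) * gauss_sum
      = (\<Sum>x\<in>UNIV. of_int (\<epsilon> * quad_char x) * \<psi> (c * x))"
    using twisted_gauss_sum[of c] by (simp add: mult.assoc sum_distrib_left [symmetric])
  moreover have "(\<Sum>x\<in>UNIV. \<psi> (c * x)) = 0"
    using sum_UNIV_mult[of c] assms by (simp add: mult.commute)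
  ultimately have "of_int (\<epsilon> * quad_char c) * gauss_sum
      = (\<Sum>x\<in>UNIV. (1 + of_int (\<epsilon> * quad_char x)) * \<psi> (c * x))"
    by (simp add: distrib_right sum.distrib)
  also have "\<dots> = (\<Sum>x\<in>UNIV. (if x = 0 then 1 else 0) + (if quad_char x = \<epsilon> then 2 * \<psi> (c * x) else 0))"
    by (rule sum.cong) (use assms in \<open>auto simp: quad_char_def zero\<close>)
  also have "\<dots> = 1 + (\<Sum>x | quad_char x = \<epsilon>. 2 * \<psi> (c * x))"
    by (simp add: sum.distrib sum.If_cases)
  finally show ?thesis by (simp add: sum_distrib_left [symmetric])
qed

section \<open>Counting subsets by orthogonality\<close>

text \<open>For each \<open>S\<close>, the sum of
  \<open>\<psi> (c * ((\<Sum>a\<in>S. a) - b))\<close> over \<open>c\<close> detects whether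
  \<open>S\<close> has sum \<open>b\<close>. For fixed \<open>c\<close>, the sum over
  \<open>S\<close> is an elementary symmetric function.\<close>

lemma subset_sum_count_eq:
  "of_nat CARD('a) * of_nat (subset_sum_count A k b)
    = (\<Sum>c\<in>UNIV. \<psi> (- (c * b)) * elem_sym (\<lambda>a. \<psi> (c * a)) A k)"
proof -
  let ?F = "{S. S \<subseteq> A \<and> card S = k}"
  have "(\<Sum>c\<in>UNIV. \<psi> (- (c * b)) * elem_sym (\<lambda>a. \<psi> (c * a)) A k)
      = (\<Sum>c\<in>UNIV. \<Sum>S\<in>?F. \<psi> (c * ((\<Sum>a\<in>S. a) - b)))"
    unfolding elem_sym_def sum_distrib_left
  proof (intro sum.cong refl)
    fix c S
    have "\<psi> (c * ((\<Sum>a\<in>S. a) - b)) = \<psi> (- (c * b) + (\<Sum>a\<in>S. c * a))"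
      by (simp add: algebra_simps sum_distrib_left)
    then show "\<psi> (- (c * b)) * (\<Prod>a\<in>S. \<psi> (c * a)) = \<psi> (c * ((\<Sum>a\<in>S. a) - b))"
      by (simp only: add char_sum[OF finite])
  qed
  also have "\<dots> = (\<Sum>S\<in>?F. \<Sum>c\<in>UNIV. \<psi> (c * ((\<Sum>a\<in>S. a) - b)))"
    by (rule sum.swap)
  also have "\<dots> = (\<Sum>S\<in>?F. if (\<Sum>a\<in>S. a) = b then of_nat CARD('a) else 0)"
    by (simp add: sum_UNIV_mult)
  also have "\<dots> = of_nat CARD('a) * of_nat (card {S \<in> ?F. (\<Sum>a\<in>S. a) = b})"
    by (simp add: sum.If_cases Int_def)
  also have "{S \<in> ?F. (\<Sum>a\<in>S. a) = b} = {S. S \<subseteq> A \<and> card S = k \<and> (\<Sum>a\<in>S. a) = b}"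
    by auto
  finally show ?thesis by (simp add: subset_sum_count_def)
qed

text \<open>The negated power sums of the values \<open>\<psi> (c * a)\<close> are exactly the cycle
  weights. Comparing characters with \<open>b\<close> in \<open>cycle_weight\<close> makes
  \<open>c\<close> enter only through \<open>g\<close>.\<close>

lemma elem_sym_nonzero_squares:
  assumes "b \<noteq> 0" "c \<noteq> 0"
  defines "g \<equiv> of_int (quad_char (c * b)) * gauss_sum"
  shows "elem_sym (\<lambda>a. \<psi> (c * a)) nonzero_squares k
    = (-1) ^ k / fact k * A_poly CHAR('a) k b ((1 - g) / 2) ((1 + g) / 2) ((1 - of_nat CARD('a)) / 2)"
proof -
  let ?w = "cycle_weight CHAR('a) b ((1 - g) / 2) ((1 + g) / 2) ((1 - of_nat CARD('a)) / 2)"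
  have weight: "- (\<Sum>a\<in>nonzero_squares. \<psi> (c * a) ^ j) = ?w j" for j
  proof -
    have *: "(\<Sum>a\<in>nonzero_squares. \<psi> (c * a) ^ j) = (\<Sum>a | quad_char a = 1. \<psi> ((of_nat j * c) * a))"
      by (simp add: nonzero_squares_eq char_of_nat_mult mult.assoc)
    show ?thesis
    proof (cases "CHAR('a) dvd j")
      case True
      then have "of_nat j = (0::'a)" by (simp add: of_nat_eq_0_iff_char_dvd)
      then have "(\<Sum>a\<in>nonzero_squares. \<psi> (c * a) ^ j) = of_nat (card (nonzero_squares :: 'a set))"
        unfolding * by (simp add: zero nonzero_squares_eq)
      moreover have "of_nat (2 * card (nonzero_squares :: 'a set)) = (of_nat CARD('a) - 1 :: complex)"
        unfolding card_nonzero_squares[OF two_neq_0] by (simp add: of_nat_diff)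
      ultimately show ?thesis
        using True by (simp add: cycle_weight_def field_simps)
    next
      case False
      then have j: "of_nat j \<noteq> (0::'a)" by (simp add: of_nat_eq_0_iff_char_dvd)
      have "(\<Sum>a\<in>nonzero_squares. \<psi> (c * a) ^ j)
          = (of_int (quad_char (of_nat j * c)) * gauss_sum - 1) / 2"
        unfolding * using sum_quad_class[of "of_nat j * c" 1] j assms by simp
      then have "- (\<Sum>a\<in>nonzero_squares. \<psi> (c * a) ^ j)
          = (1 - of_int (quad_char (of_nat j * c)) * gauss_sum) / 2"
        by simp
      \<comment> \<open>As both values are signs, \<open>quad_char (of_nat j * c)\<close> is
        \<open>quad_char (c * b)\<close> if they agree and its negative otherwise; this selects
        between the arguments \<open>u\<close> and \<open>v\<close>.\<close>
      moreover have "quad_char (of_nat j :: 'a) \<in> {-1, 1}" "quad_char b \<in> {-1, 1}"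
        using j assms by (auto simp: quad_char_def)
      ultimately show ?thesis
        using False by (auto simp: cycle_weight_def g_def quad_char_mult[OF two_neq_0])
    qed
  qed
  show ?thesis
    by (subst elem_sym_eq_cycle_sum) (simp_all add: weight A_poly_eq_cycle_sum)
qed

text \<open>The frequencies \<open>c\<close> are split into 0 and the two classes of
  \<open>quad_char (c * b)\<close>. On each class the elementary symmetric function is constant, so
  only the factor \<open>\<psi> (- (c * b))\<close> remains to be summed.\<close>

lemma subset_sum_count_nonzero_squares:
  fixes b :: 'a and k :: nat
  assumes "b \<noteq> 0"
  defines "\<delta> \<equiv> of_int (quad_char (-1 :: 'a))"
    and "A \<equiv> \<lambda>g. A_poly CHAR('a) k b ((1 - g) / 2) ((1 + g) / 2) ((1 - of_nat CARD('a)) / 2)"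
  shows "of_nat CARD('a) * of_nat (subset_sum_count nonzero_squares k b)
    = of_nat (card (nonzero_squares :: 'a set) choose k)
      - (-1) ^ k / (2 * fact k) * ((1 - \<delta> * gauss_sum) * A gauss_sum + (1 + \<delta> * gauss_sum) * A (- gauss_sum))"
proof -
  define f where "f = (\<lambda>c. \<psi> (- (c * b)) * elem_sym (\<lambda>a. \<psi> (c * a)) nonzero_squares k)"
  have class_sum: "(\<Sum>c | quad_char (c * b) = \<epsilon>. f c)
      = (of_int \<epsilon> * \<delta> * gauss_sum - 1) / 2 * ((-1) ^ k / fact k * A (of_int \<epsilon> * gauss_sum))"
    if \<epsilon>: "\<epsilon> \<in> {-1, 1}" for \<epsilon>
  proof -
    have "(\<Sum>c | quad_char (c * b) = \<epsilon>. f c)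
        = (\<Sum>c | quad_char (c * b) = \<epsilon>. \<psi> (- (c * b)) * ((-1) ^ k / fact k * A (of_int \<epsilon> * gauss_sum)))"
    proof (rule sum.cong)
      fix c assume c: "c \<in> {c. quad_char (c * b) = \<epsilon>}"
      with \<epsilon> have "c \<noteq> 0" by (auto simp: quad_char_def)
      with c show "f c = \<psi> (- (c * b)) * ((-1) ^ k / fact k * A (of_int \<epsilon> * gauss_sum))"
        unfolding f_def A_def using elem_sym_nonzero_squares[OF assms(1), of c k] by simp
    qed simp
    also have "\<dots> = (\<Sum>c | quad_char (c * b) = \<epsilon>. \<psi> (- (c * b))) * ((-1) ^ k / fact k * A (of_int \<epsilon> * gauss_sum))"
      by (rule sum_distrib_right [symmetric])
    \<comment> \<open>With \<open>x = c * b\<close> this becomes a class sum twisted by -1, which is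
      the source of \<open>\<delta>\<close>.\<close>
    also have "(\<Sum>c | quad_char (c * b) = \<epsilon>. \<psi> (- (c * b))) = (\<Sum>x | quad_char x = \<epsilon>. \<psi> (-1 * x))"
      by (rule sum.reindex_bij_witness[where i = "\<lambda>x. x / b" and j = "\<lambda>c. c * b"])
         (use assms(1) in auto)
    also have "\<dots> = (of_int \<epsilon> * \<delta> * gauss_sum - 1) / 2"
      using \<epsilon> by (subst sum_quad_class) (auto simp: \<delta>_def)
    finally show ?thesis .
  qed
  have "UNIV = insert 0 ({c. quad_char (c * b) = 1} \<union> {c. quad_char (c * b) = -1})"
    using assms(1) by (auto simp: quad_char_def)
  then have "(\<Sum>c\<in>UNIV. f c) = (\<Sum>c\<in>insert 0 ({c. quad_char (c * b) = 1} \<union> {c. quad_char (c * b) = -1}). f c)"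
    by (rule arg_cong)
  also have "\<dots> = f 0 + ((\<Sum>c | quad_char (c * b) = 1. f c) + (\<Sum>c | quad_char (c * b) = -1. f c))"
    by (subst sum.insert, simp, simp add: quad_char_def, subst sum.union_disjoint) auto
  \<comment> \<open>At \<open>c = 0\<close> every character value is 1, so the elementary symmetric
    function just counts subsets.\<close>
  also have "f 0 = of_nat (card (nonzero_squares :: 'a set) choose k)"
    by (simp add: f_def zero elem_sym_def n_subsets)
  finally have "(\<Sum>c\<in>UNIV. f c) = of_nat (card (nonzero_squares :: 'a set) choose k)
      + ((\<Sum>c | quad_char (c * b) = 1. f c) + (\<Sum>c | quad_char (c * b) = -1. f c))" .
  also have "(\<Sum>c | quad_char (c * b) = 1. f c) + (\<Sum>c | quad_char (c * b) = -1. f c)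
      = - ((-1) ^ k / (2 * fact k)
          * ((1 - \<delta> * gauss_sum) * A gauss_sum + (1 + \<delta> * gauss_sum) * A (- gauss_sum)))"
  proof -
    define X :: complex where "X = (-1) ^ k / fact k"
    have X: "(-1) ^ k / (2 * fact k) = X / 2" by (simp add: X_def)
    have "(\<Sum>c | quad_char (c * b) = 1. f c) = (\<delta> * gauss_sum - 1) / 2 * (X * A gauss_sum)"
      using class_sum[of 1] by (simp add: X_def)
    moreover have "(\<Sum>c | quad_char (c * b) = -1. f c) = (- \<delta> * gauss_sum - 1) / 2 * (X * A (- gauss_sum))"
      using class_sum[of "-1"] by (simp add: X_def)
    ultimately show ?thesis unfolding X by (simp only:) (simp add: field_simps)
  qed
  finally show ?thesis
    unfolding subset_sum_count_eq f_def [symmetric] by simp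
qed

end

section \<open>The two cases according to the quadratic character of -1\<close>

theorem theorem5p1:
  fixes p s q k :: nat and H :: "'a::{field,finite} set" and b :: 'a
    and r :: complex
  assumes "prime p" and "odd p" and "s \<ge> 1" and "q = p ^ s" and "CARD('a) = q"
    and "H = nonzero_squares"
    and "1 \<le> k" and "k \<le> card H"
    and "b \<noteq> 0"
    and "r = complex_of_real (sqrt (real q))"
  shows "real (card H) = (real q - 1) / 2 \<and>
    ([p = 1] (mod 4) \<or> ([p = 3] (mod 4) \<and> even s) \<longrightarrow>
      of_nat (subset_sum_count H k b) =
        1 / of_nat q * complex_of_real (((real q - 1) / 2) gchoose k)
        - (-1) ^ k / (2 * of_nat q * fact k) *
          ((1 - r) * A_poly p k b ((1 - r) / 2) ((1 + r) / 2) ((1 - of_nat q) / 2)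
           + (1 + r) * A_poly p k b ((1 + r) / 2) ((1 - r) / 2) ((1 - of_nat q) / 2))) \<and>
    ([p = 3] (mod 4) \<and> odd s \<longrightarrow>
      of_nat (subset_sum_count H k b) =
        1 / of_nat q * complex_of_real (((real q - 1) / 2) gchoose k)
        - (-1) ^ k / (2 * of_nat q * fact k) *
          ((1 + r * \<i>) * A_poly p k b ((1 - r * \<i>) / 2) ((1 + r * \<i>) / 2) ((1 - of_nat q) / 2)
           + (1 - r * \<i>) * A_poly p k b ((1 + r * \<i>) / 2) ((1 - r * \<i>) / 2) ((1 - of_nat q) / 2)))"
proof -
  have char: "CHAR('a) = p"
    by (rule CHAR_eq_if_card_prime_power[of p s]) (use assms in auto)
  have "\<not> p dvd 2"
    using assms by (metis prime_nat_iff primes_dvd_imp_eq two_is_prime_nat even_numeral)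
  then have two: "(2::'a) \<noteq> 0"
    using of_nat_eq_0_iff_char_dvd[where 'a = 'a, of 2] char by simp
  obtain \<psi> :: "'a \<Rightarrow> complex" where "nontrivial_additive_char \<psi>"
    using ex_nontrivial_additive_char[of p s] assms by blast
  then interpret odd_additive_char \<psi>
    by (simp add: odd_additive_char_def odd_additive_char_axioms_def two)
  define G where "G = gauss_sum"
  define A where "A = (\<lambda>g. A_poly p k b ((1 - g) / 2) ((1 + g) / 2) ((1 - of_nat q) / 2))"
  define \<delta> :: complex where "\<delta> = of_int (quad_char (-1 :: 'a))"
  have q0: "q > 0" using assms(5) by (metis zero_less_card_finite)
  have card2: "2 * card H = q - 1"
    using card_nonzero_squares[OF two] assms by simp
  then have "real (2 * card H) = real q - 1"
    using q0 by (simp add: of_nat_diff)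
  then have card: "real (card H) = (real q - 1) / 2" by simp
  \<comment> \<open>The upper argument is the natural number \<open>card H\<close>, so the
    generalized binomial is an ordinary one.\<close>
  have binom: "complex_of_real (((real q - 1) / 2) gchoose k) = of_nat (card H choose k)"
    unfolding card [symmetric] by (simp flip: binomial_gbinomial)
  have r2: "r ^ 2 = of_nat q"
    unfolding assms(10) of_real_power [symmetric] by simp
  \<comment> \<open>Replacing \<open>G\<close> by \<open>- G\<close> only swaps the two summands, so
    any square root \<open>g\<close> of \<open>G ^ 2\<close> may be used and the sign of the Gauss
    sum need not be determined.\<close>
  have count: "of_nat (subset_sum_count H k b) = 1 / of_nat q * complex_of_real (((real q - 1) / 2) gchoose k)
      - (-1) ^ k / (2 * of_nat q * fact k) * ((1 - \<delta> * g) * A g + (1 + \<delta> * g) * A (- g))"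
    if "g ^ 2 = G ^ 2" for g
  proof -
    have "of_nat q * of_nat (subset_sum_count H k b) = of_nat (card H choose k)
        - (-1) ^ k / (2 * fact k) * ((1 - \<delta> * G) * A G + (1 + \<delta> * G) * A (- G))"
      using subset_sum_count_nonzero_squares[OF assms(9), of k]
      unfolding G_def A_def \<delta>_def assms(5) assms(6) char by simp
    moreover have "g = G \<or> g = - G" using that by (simp add: power2_eq_iff)
    then have "(1 - \<delta> * G) * A G + (1 + \<delta> * G) * A (- G) = (1 - \<delta> * g) * A g + (1 + \<delta> * g) * A (- g)"
      by auto
    ultimately have "of_nat q * of_nat (subset_sum_count H k b) = of_nat (card H choose k)
        - (-1) ^ k / (2 * fact k) * ((1 - \<delta> * g) * A g + (1 + \<delta> * g) * A (- g))"
      by (simp only:)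
    then show ?thesis
      unfolding binom using q0 by (simp add: field_simps)
  qed
  have G2: "G ^ 2 = \<delta> * of_nat q"
    using gauss_sum_square by (simp add: G_def \<delta>_def assms)
  have \<delta>: "\<delta> = (-1) ^ card H"
    using quad_char_minus_1[OF two] by (simp add: \<delta>_def assms)
  show ?thesis
  proof (intro conjI impI card)
    assume p: "[p = 1] (mod 4) \<or> [p = 3] (mod 4) \<and> even s"
    \<comment> \<open>This makes \<open>(q - 1) / 2\<close> even, so -1 is a square,
      \<open>G ^ 2 = q\<close>, and \<open>g = r\<close> is admissible.\<close>
    have "q mod 4 = 1"
    proof (cases "[p = 1] (mod 4)")
      case True
      then have "[p ^ s = 1 ^ s] (mod 4)" by (rule cong_pow)
      with assms show ?thesis by (simp add: cong_def)
    next
      case False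
      with p obtain m where m: "s = 2 * m" and "[p = 3] (mod 4)" by auto
      then have "[p ^ 2 = 3 ^ 2] (mod 4)" by (intro cong_pow)
      then have "[p ^ 2 = 1] (mod 4)" by (simp add: cong_def)
      then have "[(p ^ 2) ^ m = 1 ^ m] (mod 4)" by (rule cong_pow)
      with assms m show ?thesis by (simp add: cong_def power_mult)
    qed
    then have "even (card H)" using card2 by presburger
    then have \<delta>1: "\<delta> = 1" by (simp add: \<delta>)
    have "r ^ 2 = G ^ 2" by (simp add: G2 r2 \<delta>1)
    from count[OF this] show "of_nat (subset_sum_count H k b) =
        1 / of_nat q * complex_of_real (((real q - 1) / 2) gchoose k)
        - (-1) ^ k / (2 * of_nat q * fact k) *
          ((1 - r) * A_poly p k b ((1 - r) / 2) ((1 + r) / 2) ((1 - of_nat q) / 2)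
           + (1 + r) * A_poly p k b ((1 + r) / 2) ((1 - r) / 2) ((1 - of_nat q) / 2))"
      by (simp add: \<delta>1 A_def)
  next
    assume p: "[p = 3] (mod 4) \<and> odd s"
    then obtain m where m: "s = Suc (2 * m)" by (auto elim: oddE)
    from p have p3: "[p = 3] (mod 4)" by simp
    then have "[p ^ 2 = 3 ^ 2] (mod 4)" by (rule cong_pow)
    then have "[p ^ 2 = 1] (mod 4)" by (simp add: cong_def)
    then have "[(p ^ 2) ^ m = 1 ^ m] (mod 4)" by (rule cong_pow)
    with p3 have "[p * (p ^ 2) ^ m = 3 * 1 ^ m] (mod 4)" by (rule cong_mult)
    then have "q mod 4 = 3" using assms m by (simp add: cong_def power_mult)
    then have "odd (card H)" using card2 by presburger
    then have \<delta>1: "\<delta> = -1" by (simp add: \<delta>)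
    \<comment> \<open>Here -1 is a nonsquare, so \<open>G ^ 2 = - q\<close>. The value
      \<open>\<delta> = -1\<close> also flips the signs in the outer factors, but not in the
      arguments of \<open>A_poly\<close>.\<close>
    have "(r * \<i>) ^ 2 = G ^ 2" by (simp add: G2 r2 \<delta>1 power_mult_distrib)
    from count[OF this] show "of_nat (subset_sum_count H k b) =
        1 / of_nat q * complex_of_real (((real q - 1) / 2) gchoose k)
        - (-1) ^ k / (2 * of_nat q * fact k) *
          ((1 + r * \<i>) * A_poly p k b ((1 - r * \<i>) / 2) ((1 + r * \<i>) / 2) ((1 - of_nat q) / 2)
           + (1 - r * \<i>) * A_poly p k b ((1 + r * \<i>) / 2) ((1 - r * \<i>) / 2) ((1 - of_nat q) / 2))"
      by (simp add: \<delta>1 A_def)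
  qed
qed

end
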